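(* For every non-negative integer $t$, the class of graphs with treewidth at most $t$ is fractionally $\mathrm{td}$-fragile at rate $r(a)=2^{t(t+1)/2+1}a^t$.
   Context: All graphs are finite. The treedepth $\mathrm{td}(G)$ of a graph $G$ is the minimum integer $d$ for which there exists a rooted forest $T$ of depth at most $d-1$ (each vertex is at distance at most $d-1$ from the root of its tree) with vertex set $V(G)$ such that every edge of $G$ joins a vertex to one of its ancestors or descendants in $T$; the empty graph has treedepth $0$. For $\varepsilon>0$, a probability distribution on subsets of $V(G)$ is $\varepsilon$-thin if for each vertex $v$, the probability that $v$ belongs to a set sampled from the distribution is at most $\varepsilon$. For a graph parameter $f$ and a non-decreasing function $r\colon\mathbb{N}\to\mathbb{R}_0^+$, a graph $G$ is fractionally $f$-fragile at rate $r$ if for every positive integer $a$ there exists a $(1/a)$-thin probability distribution on the collection of sets $Y\subseteq V(G)$ satisfying $f(G-Y)\le r(a)$. A class of graphs is fractionally $f$-fragile at rate $r$ if every graph in the class is. *)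

theory Defs
  imports "HOL-Probability.Probability_Mass_Function" "Graph_Theory.Pair_Digraph"
    "Graph_Theory.Digraph_Component"
begin

text \<open>
  Finite simple graphs are those satisfying the library predicate \<^const>\<open>graph\<close>: finite, loopless
  digraphs without parallel arcs in which every edge is present in both directions.
\<close>

definition delete_verts :: "('a,'b) pre_digraph \<Rightarrow> 'a set \<Rightarrow> ('a,'b) pre_digraph" where
  "delete_verts G Y = G \<restriction> (verts G - Y)"


section \<open>Treewidth\<close>

text \<open>
  The library constants \<^const>\<open>forest\<close> and \<^const>\<open>tree\<close> are not usable for undirected graphs: an edge
  traversed back and forth is a \<^const>\<open>pre_digraph.cycle\<close> of length 2. In a simple graph the cycles in the
  usual sense are exactly those of length at least 3. Connected graphs are nonempty by definition.
\<close>

definition undirected_tree :: "('a,'b) pre_digraph \<Rightarrow> bool" where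
  "undirected_tree T \<longleftrightarrow>
     graph T \<and> Digraph_Component.connected T \<and> \<not> (\<exists>p. pre_digraph.cycle T p \<and> 3 \<le> length p)"

text \<open>Trees are finite, so it is no restriction that their nodes are natural numbers.\<close>

definition tree_decomposition ::
    "('a,'b) pre_digraph \<Rightarrow> nat pair_pre_digraph \<Rightarrow> (nat \<Rightarrow> 'a set) \<Rightarrow> bool" where
  "tree_decomposition G T B \<longleftrightarrow>
     undirected_tree (with_proj T) \<and>
     (\<Union>x\<in>pverts T. B x) = verts G \<and>
     (\<forall>u v. u \<rightarrow>\<^bsub>G\<^esub> v \<longrightarrow> (\<exists>x\<in>pverts T. u \<in> B x \<and> v \<in> B x)) \<and>
     (\<forall>v\<in>verts G. Digraph_Component.connected (with_proj T \<restriction> {x \<in> pverts T. v \<in> B x}))"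

definition decomposition_width :: "nat pair_pre_digraph \<Rightarrow> (nat \<Rightarrow> 'a set) \<Rightarrow> int" where
  "decomposition_width T B = Max ((\<lambda>x. int (card (B x))) ` pverts T) - 1"

text \<open>
  The widths are integers, so that the empty graph has treewidth \<open>-1\<close>. The minimum exists for every
  finite graph, see \<open>treewidth_attained\<close> below.
\<close>

definition treewidth :: "('a,'b) pre_digraph \<Rightarrow> int" where
  "treewidth G = (LEAST w. \<exists>T B. tree_decomposition G T B \<and> decomposition_width T B = w)"


section \<open>Treedepth\<close>

text \<open>
  A rooted forest is represented with its arcs directed from parents to children, so the roots are the
  vertices without incoming arcs and \<open>u\<close> is an ancestor of \<open>v\<close> iff \<open>v\<close> is reachable from \<open>u\<close>.
\<close>

definition rooted_forest :: "'a pair_pre_digraph \<Rightarrow> bool" where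
  "rooted_forest F \<longleftrightarrow>
     pair_fin_digraph F \<and> acyclic (parcs F) \<and> (\<forall>v\<in>pverts F. in_degree (with_proj F) v \<le> 1)"

definition forest_roots :: "'a pair_pre_digraph \<Rightarrow> 'a set" where
  "forest_roots F = {r \<in> pverts F. in_degree (with_proj F) r = 0}"

text \<open>
  The depth of the forest is at most \<open>d - 1\<close>. Writing this as a strict inequality gives the right reading
  for \<open>d = 0\<close>, where only the empty forest qualifies.
  There is only one walk from a root to a given vertex, so the length of such a walk is the distance.
\<close>

definition depth_less :: "'a pair_pre_digraph \<Rightarrow> nat \<Rightarrow> bool" where
  "depth_less F d \<longleftrightarrow>
     (\<forall>v\<in>pverts F. \<exists>r\<in>forest_roots F. \<exists>n<d. (r, v) \<in> parcs F ^^ n)"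

definition treedepth_forest :: "('a,'b) pre_digraph \<Rightarrow> 'a pair_pre_digraph \<Rightarrow> bool" where
  "treedepth_forest G F \<longleftrightarrow>
     rooted_forest F \<and> pverts F = verts G \<and>
     (\<forall>u v. u \<rightarrow>\<^bsub>G\<^esub> v \<longrightarrow> u \<rightarrow>\<^sup>*\<^bsub>with_proj F\<^esub> v \<or> v \<rightarrow>\<^sup>*\<^bsub>with_proj F\<^esub> u)"

definition treedepth :: "('a,'b) pre_digraph \<Rightarrow> nat" where
  "treedepth G = (LEAST d. \<exists>F. treedepth_forest G F \<and> depth_less F d)"


section \<open>Fractional fragility\<close>

definition thin :: "('a,'b) pre_digraph \<Rightarrow> real \<Rightarrow> 'a set pmf \<Rightarrow> bool" where
  "thin G \<epsilon> p \<longleftrightarrow> (\<forall>v\<in>verts G. measure_pmf.prob p {Y. v \<in> Y} \<le> \<epsilon>)"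

definition rate_function :: "(nat \<Rightarrow> real) \<Rightarrow> bool" where
  "rate_function r \<longleftrightarrow> mono r \<and> (\<forall>a. 0 \<le> r a)"

definition fractionally_fragile ::
    "(('a,'b) pre_digraph \<Rightarrow> real) \<Rightarrow> (nat \<Rightarrow> real) \<Rightarrow> ('a,'b) pre_digraph \<Rightarrow> bool" where
  "fractionally_fragile f r G \<longleftrightarrow>
     rate_function r \<and>
     (\<forall>a\<ge>1. \<exists>p. set_pmf p \<subseteq> {Y. Y \<subseteq> verts G \<and> f (delete_verts G Y) \<le> r a} \<and> thin G (1 / real a) p)"

definition fractionally_fragile_class ::
    "(('a,'b) pre_digraph \<Rightarrow> real) \<Rightarrow> (nat \<Rightarrow> real) \<Rightarrow> ('a,'b) pre_digraph set \<Rightarrow> bool" where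
  "fractionally_fragile_class f r \<G> \<longleftrightarrow> (\<forall>G\<in>\<G>. fractionally_fragile f r G)"


section \<open>Existence of the minima\<close>

lemma connected_singleton:
  "verts G = {x} \<Longrightarrow> Digraph_Component.connected G"
  by (auto simp: connected_def strongly_connected_def mk_symmetric_def reachable_def)

lemma trivial_tree_decomposition:
  assumes "graph G"
  shows "tree_decomposition G (\<lparr>pverts = {0}, parcs = {}\<rparr>) (\<lambda>_. verts G)"
proof -
  interpret graph G by fact
  let ?T = "\<lparr>pverts = {0::nat}, parcs = {}\<rparr>"
  have "graph (with_proj ?T)"
    by unfold_locales (auto simp: symmetric_def arcs_ends_def sym_def)
  moreover have "\<not> (\<exists>p. pre_digraph.cycle (with_proj ?T) p \<and> 3 \<le> length p)"
    by (auto simp: pre_digraph.cycle_def pre_digraph.awalk_def)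
  ultimately have "undirected_tree (with_proj ?T)"
    by (simp add: undirected_tree_def connected_singleton)
  then show ?thesis
    by (auto simp: tree_decomposition_def adj_in_verts intro: connected_singleton)
qed

lemma treewidth_attained:
  assumes "graph G"
  shows "\<exists>T B. tree_decomposition G T B \<and> decomposition_width T B = treewidth G"
    and "\<And>T B. tree_decomposition G T B \<Longrightarrow> treewidth G \<le> decomposition_width T B"
proof -
  let ?P = "\<lambda>w. \<exists>T B. tree_decomposition G T B \<and> decomposition_width T B = w"
  have lower: "-1 \<le> decomposition_width T B" if "tree_decomposition G T B" for T B
  proof -
    from that have "graph (with_proj T)" "Digraph_Component.connected (with_proj T)"
      by (simp_all add: tree_decomposition_def undirected_tree_def)
    then interpret T: graph "with_proj T" by simp
    have "finite (pverts T)"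
      using T.finite_verts by simp
    moreover have "pverts T \<noteq> {}"
      using \<open>Digraph_Component.connected (with_proj T)\<close>
      by (simp add: connected_def strongly_connected_def mk_symmetric_def)
    ultimately have "0 \<le> Max ((\<lambda>x. int (card (B x))) ` pverts T)"
      by (subst Max_ge_iff) auto
    then show ?thesis by (simp add: decomposition_width_def)
  qed
  define k where "k = (LEAST k. ?P (int k - 1))"
  have "\<exists>k. ?P (int k - 1)"
  proof -
    obtain T B where td: "tree_decomposition G T B"
      using trivial_tree_decomposition[OF assms] by blast
    from lower[OF td] have "decomposition_width T B = int (nat (decomposition_width T B + 1)) - 1"
      by linarith
    with td show ?thesis by blast
  qed
  then have k1: "?P (int k - 1)" unfolding k_def by (rule LeastI_ex)
  have k2: "k \<le> j" if "?P (int j - 1)" for j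
    unfolding k_def using that by (rule Least_le)
  have min: "int k - 1 \<le> w" if "?P w" for w
  proof -
    from that obtain T B where TB: "tree_decomposition G T B" "decomposition_width T B = w"
      by blast
    with lower have "-1 \<le> w" by metis
    then have "int (nat (w + 1)) - 1 = w" by simp
    with that have "?P (int (nat (w + 1)) - 1)" by metis
    from k2[OF this] \<open>-1 \<le> w\<close> show ?thesis by linarith
  qed
  have "treewidth G = int k - 1"
    unfolding treewidth_def using k1 min by (rule Least_equality)
  with k1 show "?P (treewidth G)" by metis
  show "treewidth G \<le> decomposition_width T B" if "tree_decomposition G T B" for T B
    using min that \<open>treewidth G = int k - 1\<close> by metis
qed

text \<open>A path through all the vertices shows that the minimum in the definition of treedepth exists.\<close>

lemma treedepth_attained:
  assumes "graph G"
  shows "\<exists>F. treedepth_forest G F \<and> depth_less F (treedepth G)"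
proof -
  interpret graph G by fact
  obtain n h where bij: "bij_betw h {..<n::nat} (verts G)"
    using ex_bij_betw_nat_finite[OF finite_verts] by (auto simp: atLeast0LessThan)
  define A where "A = {(h i, h (Suc i)) | i. Suc i < n}"
  let ?F = "\<lparr>pverts = verts G, parcs = A\<rparr>"
  have inj: "h i = h j \<longleftrightarrow> i = j" if "i < n" "j < n" for i j
    using bij that by (auto simp: bij_betw_def inj_on_def)
  have V: "verts G = h ` {..<n}" using bij by (simp add: bij_betw_def)
  have rank: "\<exists>i j. x = h i \<and> y = h j \<and> i < j \<and> j < n" if "(x, y) \<in> A\<^sup>+" for x y
    using that
  proof (induction rule: trancl_induct)
    case (base y)
    then show ?case by (auto simp: A_def)
  next
    case (step y z)
    then obtain i j k where "x = h i" "y = h j" "i < j" "j < n" "y = h k" "z = h (Suc k)" "Suc k < n"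
      by (auto simp: A_def)
    moreover from this have "k = j" using inj[of k j] by simp
    ultimately show ?case by (intro exI[of _ i] exI[of _ "Suc k"]) auto
  qed
  have acyc: "acyclic A"
    unfolding acyclic_def using rank inj by (metis less_trans nat_neq_iff)
  have path: "(h i, h (i + k)) \<in> A ^^ k" if "i + k < n" for i k
    using that
  proof (induction k)
    case (Suc k)
    then have "(h (i + k), h (Suc (i + k))) \<in> A" by (auto simp: A_def)
    with Suc show ?case by auto
  qed auto
  have A_sub: "A \<subseteq> verts G \<times> verts G" by (auto simp: A_def V)
  then have fin: "pair_fin_digraph ?F"
    using finite_subset[OF A_sub] by unfold_locales auto
  have indeg: "in_degree (with_proj ?F) v \<le> 1" for v
  proof -
    have "e = e'" if "e \<in> in_arcs (with_proj ?F) v" "e' \<in> in_arcs (with_proj ?F) v" for e e'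
    proof -
      from that have "e \<in> A" "e' \<in> A" and same: "snd e = snd e'" by auto
      then obtain i j where "e = (h i, h (Suc i))" "e' = (h j, h (Suc j))" "Suc i < n" "Suc j < n"
        unfolding A_def by blast
      with same inj[of "Suc i" "Suc j"] show ?thesis by simp
    qed
    then show ?thesis unfolding in_degree_def One_nat_def
      by (metis card.infinite card_le_Suc0_iff_eq le0)
  qed
  have root: "h 0 \<in> forest_roots ?F" if "0 < n"
  proof -
    have "in_arcs (with_proj ?F) (h 0) = {}" using inj that by (auto simp: A_def)
    then show ?thesis using that by (auto simp: forest_roots_def in_degree_def V)
  qed
  have "depth_less ?F n"
    unfolding depth_less_def
  proof
    fix v assume "v \<in> pverts ?F"
    then obtain i where "i < n" "v = h i" by (auto simp: V)
    then show "\<exists>r\<in>forest_roots ?F. \<exists>n'<n. (r, v) \<in> parcs ?F ^^ n'"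
      using path[of 0 i] root by auto
  qed
  moreover have "u \<rightarrow>\<^sup>*\<^bsub>with_proj ?F\<^esub> v \<or> v \<rightarrow>\<^sup>*\<^bsub>with_proj ?F\<^esub> u" if uv: "u \<rightarrow>\<^bsub>G\<^esub> v" for u v
  proof -
    interpret F: pair_fin_digraph ?F by (fact fin)
    obtain i j where ij: "u = h i" "v = h j" "i < n" "j < n"
      using adj_in_verts[OF uv] by (auto simp: V)
    have "(h k, h l) \<in> A\<^sup>*" if "k \<le> l" "l < n" for k l
      using path[of k "l - k"] that by (auto intro: relpow_imp_rtrancl)
    with ij have "(u, v) \<in> A\<^sup>* \<or> (v, u) \<in> A\<^sup>*" by (meson nat_le_linear)
    then show ?thesis using adj_in_verts[OF uv] by (auto simp: F.reachable_conv)
  qed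
  ultimately have "\<exists>F. treedepth_forest G F \<and> depth_less F n"
    using fin acyc indeg by (intro exI[of _ ?F]) (auto simp: treedepth_forest_def rooted_forest_def)
  then show ?thesis unfolding treedepth_def by (rule LeastI)
qed

end

theory Submission
  imports Defs
begin

text \<open>
  Completing the bags of a tree decomposition of width \<open>t\<close> to cliques yields a chordal supergraph with
  a vertex ordering in which the earlier neighbours of each vertex form a clique of size at most \<open>t\<close>.
  Put vertices without earlier neighbours on level 0 and every other vertex one level above its lowest
  earlier neighbour. Then adjacent levels differ by at most one, inside a level each vertex has at most
  \<open>t - 1\<close> earlier neighbours, and a path that stays on levels \<open>\<ge> i\<close> can be short-cut to level \<open>i\<close>, since
  a last vertex above level \<open>i\<close> has a clique as neighbourhood.

  Let \<open>r t a\<close> bound the treedepth achieved with deletion probability \<open>1 / a\<close>. By induction, a random set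
  hitting each vertex with probability at most \<open>1 / (2 a)\<close> leaves treedepth at most \<open>r (t - 1) (2 a)\<close>
  inside all levels simultaneously. In addition, delete every \<open>2 a\<close>-th level, with a random offset.
  Ordering colours of centered colourings lexicographically by (level, colour inside the level) shows
  that the remaining treedepth is at most \<open>r t a = 2 a * r (t - 1) (2 a)\<close>.
\<close>

section \<open>Walks inside a vertex set and simplicial vertices\<close>

abbreviation reach_in :: "'a rel \<Rightarrow> 'a set \<Rightarrow> 'a rel" where
  "reach_in E S \<equiv> (E \<inter> S \<times> S)\<^sup>*"

lemma reach_in_mono: "S \<subseteq> S' \<Longrightarrow> p \<in> reach_in E S \<Longrightarrow> p \<in> reach_in E S'"
  using rtrancl_mono[of "E \<inter> S \<times> S" "E \<inter> S' \<times> S'"] by blast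

lemma sym_reach_in: "sym E \<Longrightarrow> sym (reach_in E S)"
  by (intro sym_rtrancl) (auto simp: sym_def)

text \<open>The neighbours of \<open>v\<close> in \<open>S\<close> form a clique, so a visit of a
  walk to \<open>v\<close> can be replaced by an edge between the vertices before and after it, or
  dropped if they coincide. A walk ending in \<open>v\<close> is cut off at a neighbour of
  \<open>v\<close>.\<close>

lemma reach_in_remove_simplicial:
  assumes "sym E"
    and clique: "pairwise (\<lambda>u w. (u, w) \<in> E) {u \<in> S - {v}. (u, v) \<in> E}"
    and "(x, y) \<in> reach_in E S" and "x \<noteq> v"
  shows "if y \<noteq> v then (x, y) \<in> reach_in E (S - {v})
    else \<exists>u\<in>S - {v}. (u, v) \<in> E \<and> (x, u) \<in> reach_in E (S - {v})"
  using assms(3)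
proof (induction rule: rtrancl_induct)
  case base
  then show ?case using \<open>x \<noteq> v\<close> by simp
next
  case (step y z)
  show ?case
  proof (cases "y = v")
    case False
    then show ?thesis using step by (auto intro: rtrancl_into_rtrancl)
  next
    case True
    show ?thesis
    proof (cases "z = v")
      case False
      from step \<open>y = v\<close> obtain u where u: "u \<in> S - {v}" "(u, v) \<in> E" "(x, u) \<in> reach_in E (S - {v})"
        by auto
      have "z \<in> S - {v}" "(z, v) \<in> E" using step \<open>y = v\<close> False \<open>sym E\<close> by (auto dest: symD)
      with u pairwiseD[OF clique, of u z] show ?thesis using False
        by (cases "u = z") (auto intro: rtrancl_into_rtrancl)
    qed (use step True in auto)
  qed
qed

section \<open>Elimination orderings and layerings\<close>

text \<open>\<open>V\<close> is built up along the reverse of a perfect elimination ordering.\<close>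

inductive eliminable :: "nat \<Rightarrow> 'a rel \<Rightarrow> 'a set \<Rightarrow> bool" for k E where
  empty: "eliminable k E {}"
| insert: "eliminable k E V \<Longrightarrow> v \<notin> V
    \<Longrightarrow> (\<And>u w. u \<in> V \<Longrightarrow> w \<in> V \<Longrightarrow> (u, v) \<in> E \<Longrightarrow> (w, v) \<in> E \<Longrightarrow> u \<noteq> w \<Longrightarrow> (u, w) \<in> E)
    \<Longrightarrow> card {u \<in> V. (u, v) \<in> E} \<le> k \<Longrightarrow> eliminable k E (insert v V)"

lemma eliminable_finite: "eliminable k E V \<Longrightarrow> finite V"
  by (induction rule: eliminable.induct) auto

lemma eliminable_cong:
  assumes "eliminable k E V"
    and "\<And>u w. u \<in> V \<Longrightarrow> w \<in> V \<Longrightarrow> (u, w) \<in> E \<longleftrightarrow> (u, w) \<in> E'"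
  shows "eliminable k E' V"
  using assms
proof (induction rule: eliminable.induct)
  case empty
  show ?case by (rule eliminable.empty)
next
  case (insert V v)
  have "{u \<in> V. (u, v) \<in> E'} = {u \<in> V. (u, v) \<in> E}" using insert.prems by auto
  then show ?case using insert
    by (intro eliminable.insert) (auto simp: insert.prems)
qed

abbreviation same_level :: "('a \<Rightarrow> nat) \<Rightarrow> 'a rel \<Rightarrow> 'a rel" where
  "same_level lev E \<equiv> {(u, w) \<in> E. lev u = lev w}"

text \<open>The short-cut property is demanded for every subset \<open>S\<close>, since it is
  applied to sets cut out by deletions and colour thresholds; all of \<open>S\<close> lies on or
  above the level of \<open>x\<close>.\<close>

definition layering :: "'a rel \<Rightarrow> 'a set \<Rightarrow> ('a \<Rightarrow> nat) \<Rightarrow> bool" where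
  "layering E V lev \<longleftrightarrow>
     (\<forall>u\<in>V. \<forall>w\<in>V. (u, w) \<in> E \<longrightarrow> lev w \<le> Suc (lev u)) \<and>
     (\<forall>S\<subseteq>V. \<forall>x\<in>S. \<forall>y\<in>S. lev x = lev y \<longrightarrow> (\<forall>z\<in>S. lev x \<le> lev z) \<longrightarrow>
        (x, y) \<in> reach_in E S \<longrightarrow> (x, y) \<in> reach_in (same_level lev E) S)"

lemma layeringD_step:
  "layering E V lev \<Longrightarrow> u \<in> V \<Longrightarrow> w \<in> V \<Longrightarrow> (u, w) \<in> E \<Longrightarrow> lev w \<le> Suc (lev u)"
  by (simp add: layering_def)

lemma layeringD_reach:
  assumes "layering E V lev" and "S \<subseteq> V" "x \<in> S" "y \<in> S" "lev x = lev y"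
    "\<And>z. z \<in> S \<Longrightarrow> lev x \<le> lev z" "(x, y) \<in> reach_in E S"
  shows "(x, y) \<in> reach_in (same_level lev E) S"
  by (rule assms(1)[unfolded layering_def, THEN conjunct2, rule_format, OF assms(2-7)])

lemma layering_subset: "layering E V lev \<Longrightarrow> W \<subseteq> V \<Longrightarrow> layering E W lev"
  unfolding layering_def by (meson subset_trans subsetD)

text \<open>Induction along the ordering. The new vertex \<open>v\<close> is simplicial, so walks
  between older vertices can avoid it and the old short-cuts apply. If \<open>v\<close> has older
  neighbours, it is put one level above the lowest of them, so at least that one is lost inside the
  level of \<open>v\<close>.\<close>

lemma eliminable_levels:
  assumes "eliminable (Suc k) E V" and "sym E"
  shows "\<exists>lev. eliminable k (same_level lev E) V \<and> layering E V lev"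
  using assms(1)
proof (induction rule: eliminable.induct)
  case empty
  then show ?case by (auto simp: layering_def intro: eliminable.empty)
next
  case (insert V v)
  from insert.IH obtain lev where el: "eliminable k (same_level lev E) V" and lay: "layering E V lev"
    by blast
  note step = layeringD_step[OF lay] and short = layeringD_reach[OF lay]
  define K where "K = {u \<in> V. (u, v) \<in> E}"
  define n where "n = (if K = {} then 0 else Suc (Min (lev ` K)))"
  define lev' where "lev' = lev(v := n)"
  have "finite K" using eliminable_finite[OF insert.hyps(1)] by (simp add: K_def)
  have lev'_V: "lev' u = lev u" if "u \<in> V" for u
    using that insert.hyps(2) by (auto simp: lev'_def)
  have lev'_v: "lev' v = n" by (simp add: lev'_def)
  have K_level: "lev u \<le> n \<and> n \<le> Suc (lev u)" if "u \<in> K" for u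
  proof -
    have "Min (lev ` K) \<in> lev ` K" using that \<open>finite K\<close> by (intro Min_in) auto
    then obtain m where m: "m \<in> K" "lev m = Min (lev ` K)" by auto
    have "n = Suc (lev m)" using that m by (auto simp: n_def)
    moreover have "lev m \<le> lev u" using m that \<open>finite K\<close> by simp
    \<comment> \<open>Both \<open>m\<close> and \<open>u\<close> are neighbours of \<open>v\<close>,
      hence equal or adjacent, and levels of adjacent vertices differ by at most one.\<close>
    moreover have "lev u \<le> Suc (lev m)"
      using step[of m u] insert.hyps(3)[of m u] m(1) that by (cases "m = u") (auto simp: K_def)
    ultimately show ?thesis by simp
  qed
  have el': "eliminable k (same_level lev' E) V"
    using el by (rule eliminable_cong) (auto simp: lev'_V)
  have card: "card {u \<in> V. (u, v) \<in> same_level lev' E} \<le> k"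
  proof (cases "K = {}")
    case True
    then have "{u \<in> V. (u, v) \<in> same_level lev' E} = {}" by (auto simp: K_def)
    then show ?thesis by (metis card.empty le0)
  next
    case False
    have "Min (lev ` K) \<in> lev ` K" using False \<open>finite K\<close> by (intro Min_in) auto
    then obtain m where m: "m \<in> K" "lev m = Min (lev ` K)" by auto
    then have "m \<notin> {u \<in> V. (u, v) \<in> same_level lev' E}"
      using False by (auto simp: lev'_v lev'_V n_def)
    with m have "{u \<in> V. (u, v) \<in> same_level lev' E} \<subset> K" by (auto simp: K_def)
    then have "card {u \<in> V. (u, v) \<in> same_level lev' E} < card K"
      using \<open>finite K\<close> by (rule psubset_card_mono[rotated])
    then show ?thesis using insert.hyps(4) by (simp add: K_def)
  qed
  have "eliminable k (same_level lev' E) (insert v V)"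
    using insert.hyps(2,3) by (intro eliminable.insert el' card) auto
  moreover have "lev' w \<le> Suc (lev' u)" if "u \<in> insert v V" "w \<in> insert v V" "(u, w) \<in> E" for u w
  proof -
    have "(w, u) \<in> E" using that \<open>sym E\<close> by (auto dest: symD)
    then show ?thesis
      using that step[of u w] K_level[of u] K_level[of w] insert.hyps(2)
      by (cases "u = v"; cases "w = v") (auto simp: lev'_v lev'_V K_def)
  qed
  moreover have "(x, y) \<in> reach_in (same_level lev' E) S"
    if S: "S \<subseteq> insert v V" "x \<in> S" "y \<in> S" "lev' x = lev' y" "\<And>z. z \<in> S \<Longrightarrow> lev' x \<le> lev' z"
      and xy: "(x, y) \<in> reach_in E S" for S x y
  proof -
    have cliq: "pairwise (\<lambda>u w. (u, w) \<in> E) {u \<in> S - {v}. (u, v) \<in> E}"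
      using insert.hyps(3) S(1) by (auto simp: pairwise_def)
    have short': "(p, q) \<in> reach_in (same_level lev' E) S"
      if "p \<in> S - {v}" "q \<in> S - {v}" "lev' p = lev' x" "lev' q = lev' x"
        "(p, q) \<in> reach_in E (S - {v})" for p q
    proof -
      have sub: "S - {v} \<subseteq> V" using S(1) by auto
      have pq: "lev p = lev' x" "lev q = lev' x"
        using that(1-4) sub lev'_V[of p] lev'_V[of q] by auto
      have "lev p \<le> lev z" if "z \<in> S - {v}" for z
        using that S(5)[of z] sub lev'_V[of z] pq by auto
      then have "(p, q) \<in> reach_in (same_level lev E) (S - {v})"
        using that(1,2,5) sub pq by (intro short) simp_all
      also have "same_level lev E \<inter> (S - {v}) \<times> (S - {v}) = same_level lev' E \<inter> (S - {v}) \<times> (S - {v})"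
        using sub lev'_V by (auto simp: subset_iff)
      finally show ?thesis by (rule reach_in_mono[rotated]) auto
    qed
    have from_other: "(p, q) \<in> reach_in (same_level lev' E) S"
      if pq: "p \<in> S - {v}" "q \<in> S" "lev' p = lev' x" "lev' q = lev' x" "(p, q) \<in> reach_in E S" for p q
    proof (cases "q = v")
      case False
      then have "(p, q) \<in> reach_in E (S - {v})"
        using reach_in_remove_simplicial[OF \<open>sym E\<close> cliq pq(5)] pq(1) by auto
      then show ?thesis using pq False by (intro short') auto
    next
      case True
      then obtain u where u: "u \<in> S - {v}" "(u, v) \<in> E" "(p, u) \<in> reach_in E (S - {v})"
        using reach_in_remove_simplicial[OF \<open>sym E\<close> cliq pq(5)] pq(1) by auto
      then have "u \<in> K" using S(1) by (auto simp: K_def)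
      \<comment> \<open>No vertex of \<open>S\<close> lies below \<open>x\<close>, and by
        \<open>K_level\<close> the neighbour \<open>u\<close> is not above \<open>v\<close>, which
        here is on the level of \<open>x\<close>.\<close>
      have "lev' u = lev' x"
        using K_level[OF \<open>u \<in> K\<close>] S(5)[of u] u(1) pq(4) \<open>u \<in> K\<close> True
        by (auto simp: K_def lev'_V lev'_v intro!: antisym)
      then have "(p, u) \<in> reach_in (same_level lev' E) S"
        using pq u by (intro short') auto
      moreover have "(u, q) \<in> same_level lev' E \<inter> S \<times> S"
        using u True \<open>lev' u = lev' x\<close> pq by auto
      ultimately show ?thesis by (rule rtrancl_into_rtrancl)
    qed
    have sym': "sym (same_level lev' E)" using \<open>sym E\<close> by (auto simp: sym_def)
    show ?thesis
    proof (cases "x = v")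
      case False
      then show ?thesis using S xy by (intro from_other) auto
    next
      case True
      show ?thesis
      proof (cases "y = v")
        case False
        \<comment> \<open>Reversing the walk makes it start at a vertex other than
          \<open>v\<close>.\<close>
        have "(y, x) \<in> reach_in E S" using xy sym_reach_in[OF \<open>sym E\<close>] by (auto dest: symD)
        then have "(y, x) \<in> reach_in (same_level lev' E) S"
          using False S by (intro from_other) auto
        then show ?thesis using sym_reach_in[OF sym'] by (auto dest: symD)
      qed (use True in auto)
    qed
  qed
  ultimately show ?case unfolding layering_def
    by (intro exI[of _ lev'] conjI ballI allI impI) simp_all
qed

section \<open>Centered colourings from levels\<close>

text \<open>
  Colours are ordered from the root downwards: a path between two vertices of the same colour contains a
  smaller colour. Such a colouring with \<open>d\<close> colours exists iff the treedepth is at most \<open>d\<close>.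
\<close>

definition centered :: "'a rel \<Rightarrow> 'a set \<Rightarrow> ('a \<Rightarrow> nat) \<Rightarrow> bool" where
  "centered E W c \<longleftrightarrow> (\<forall>x\<in>W. \<forall>y\<in>W.
     c x = c y \<longrightarrow> (x, y) \<in> reach_in E {w \<in> W. c x \<le> c w} \<longrightarrow> x = y)"

lemma div_mod_Suc:
  fixes n m :: nat
  assumes "Suc n mod m \<noteq> 0"
  shows "Suc n div m = n div m"
  using assms by (simp add: div_Suc mod_Suc split: if_splits)

lemma le_if_div_eq_mod_le:
  fixes a b m :: nat
  assumes "a div m = b div m" and "a mod m \<le> b mod m"
  shows "a \<le> b"
proof -
  have "a div m * m + a mod m \<le> b div m * m + b mod m"
    unfolding assms(1) by (rule add_left_mono[OF assms(2)])
  then show ?thesis by (simp only: div_mult_mod_eq)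
qed

text \<open>The new colour encodes the pair of shifted level modulo \<open>m\<close> and
  \<open>c\<close> lexicographically, with base \<open>d\<close>. No vertex has residue 0, so a walk
  never leaves its block of consecutive levels, and inside a block residues are ordered like levels.
  A walk over colours at least that of \<open>x\<close> thus stays on or above \<open>lev x\<close>;
  it short-cuts to that level, where \<open>c\<close> is centered.\<close>

lemma centered_of_levels:
  assumes "sym E"
    and lay: "layering E W lev"
    and gap: "\<And>w. w \<in> W \<Longrightarrow> (lev w + s) mod m \<noteq> 0"
    and c: "centered (same_level lev E) W c" "\<And>w. w \<in> W \<Longrightarrow> c w < d"
  shows "centered E W (\<lambda>w. ((lev w + s) mod m) * d + c w)" (is "centered E W ?c")
proof -
  note step = layeringD_step[OF lay] and short = layeringD_reach[OF lay]
  define r where "r w = (lev w + s) mod m" for w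
  define q where "q w = (lev w + s) div m" for w
  define C where "C w = r w * d + c w" for w
  have le: "r u \<le> r w" if "w \<in> W" "C u \<le> C w" for u w
  proof (rule ccontr)
    assume "\<not> r u \<le> r w"
    then have "Suc (r w) * d \<le> r u * d" by (intro mult_le_mono1) simp
    then show False using that c(2)[of w] by (simp add: C_def)
  qed
  have q: "q u = q w" if "u \<in> W" "w \<in> W" "(u, w) \<in> E" for u w
  proof -
    have "(w, u) \<in> E" using that \<open>sym E\<close> by (auto dest: symD)
    with that step[of u w] step[of w u]
    consider "lev u = lev w" | "lev w = Suc (lev u)" | "lev u = Suc (lev w)"
      by (metis le_SucE le_antisym)
    \<comment> \<open>The quotient could change only on entering a level of residue 0, which
      \<open>gap\<close> excludes.\<close>
    then show ?thesis
      using gap[of u] gap[of w] that div_mod_Suc[of "lev u + s" m] div_mod_Suc[of "lev w + s" m]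
      by cases (auto simp: q_def)
  qed
  have lev_le: "lev u \<le> lev w" if "q u = q w" "r u \<le> r w" for u w
    using le_if_div_eq_mod_le[of "lev u + s" m "lev w + s"] that by (simp add: q_def r_def)
  have eq: "x = y"
    if xy: "x \<in> W" "y \<in> W" "C x = C y" "(x, y) \<in> reach_in E {w \<in> W. C x \<le> C w}" for x y
  proof -
    \<comment> \<open>Residues compare levels only within one block; restricting to the block of
      \<open>x\<close> puts \<open>x\<close> on the lowest level of \<open>S\<close>.\<close>
    define S where "S = {w \<in> W. C x \<le> C w \<and> q w = q x}"
    have S: "(x, z) \<in> reach_in E S \<and> q z = q x"
      if "(x, z) \<in> reach_in E {w \<in> W. C x \<le> C w}" for z
      using that
    proof (induction rule: rtrancl_induct)
      case (step u w)
      then have "(u, w) \<in> E \<inter> S \<times> S" "q w = q x"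
        using q[of u w] by (auto simp: S_def)
      with step.IH show ?case by (metis rtrancl_into_rtrancl)
    qed simp
    have "r x = r y" using le[of x y] le[of y x] xy by simp
    have "q y = q x" using S xy(4) by blast
    have "lev x = lev y"
      using lev_le[of x y] lev_le[of y x] \<open>r x = r y\<close> \<open>q y = q x\<close> by simp
    have min: "lev x \<le> lev z" if "z \<in> S" for z
      using that le lev_le by (auto simp: S_def)
    have xS: "x \<in> S" and yS: "y \<in> S" using xy(1-3) \<open>q y = q x\<close> by (simp_all add: S_def)
    have SW: "S \<subseteq> W" by (auto simp: S_def)
    have "(x, y) \<in> reach_in E S" using S[OF xy(4)] by (rule conjunct1)
    then have path: "(x, y) \<in> reach_in (same_level lev E) S"
      by (intro short[OF SW xS yS \<open>lev x = lev y\<close>] min)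
    have "c x = c y" using xy(3) \<open>r x = r y\<close> by (simp add: C_def)
    \<comment> \<open>On a single level the residue is constant, so the threshold on
      \<open>C\<close> becomes one on \<open>c\<close>.\<close>
    have path': "(x, z) \<in> reach_in (same_level lev E) {w \<in> W. c x \<le> c w} \<and> r z = r x"
      if "(x, z) \<in> reach_in (same_level lev E) S" for z
      using that
    proof (induction rule: rtrancl_induct)
      case (step u w)
      then have uw: "u \<in> S" "w \<in> S" "(u, w) \<in> same_level lev E" by auto
      have r: "r u = r x" "r w = r x" using step.IH uw(3) by (auto simp: r_def)
      then have "c x \<le> c u" "c x \<le> c w" using uw(1,2) by (auto simp: S_def C_def)
      then have "(u, w) \<in> same_level lev E \<inter> {w \<in> W. c x \<le> c w} \<times> {w \<in> W. c x \<le> c w}"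
        using uw SW by auto
      with conjunct1[OF step.IH] have "(x, w) \<in> reach_in (same_level lev E) {w \<in> W. c x \<le> c w}"
        by (rule rtrancl_into_rtrancl)
      with r(2) show ?case by (rule conjI[rotated])
    qed simp
    show "x = y"
      by (rule c(1)[unfolded centered_def, rule_format, OF xy(1,2) \<open>c x = c y\<close>])
        (rule conjunct1[OF path'[OF path]])
  qed
  show ?thesis
    unfolding centered_def by (intro ballI impI) (rule eq[unfolded C_def r_def])
qed

lemma centered_subset:
  assumes "centered E W c" and "W' \<subseteq> W"
  shows "centered E W' c"
proof -
  have "(x, y) \<in> reach_in E {w \<in> W. c x \<le> c w}" if "(x, y) \<in> reach_in E {w \<in> W'. c x \<le> c w}" for x y
    using that by (rule reach_in_mono[rotated]) (use assms(2) in auto)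
  then show ?thesis using assms unfolding centered_def by (meson subsetD)
qed

section \<open>Random deletion of levels\<close>

text \<open>Base case of the induction on \<open>t\<close>. Loops are compatible with
  \<open>eliminable\<close>, hence the conclusion \<open>u = w\<close>.\<close>

lemma eliminable_0_no_edge:
  assumes "eliminable 0 E V" and "sym E" and "u \<in> V" and "w \<in> V" and "(u, w) \<in> E"
  shows "u = w"
  using assms(1,3-5)
proof (induction arbitrary: u w rule: eliminable.induct)
  case empty
  then show ?case by simp
next
  case (insert V v)
  have no: "(x, v) \<notin> E" if "x \<in> V" for x
    using insert.hyps(4) eliminable_finite[OF insert.hyps(1)] that by auto
  then have "(v, x) \<notin> E" if "x \<in> V" for x
    using that \<open>sym E\<close> by (auto dest: symD)
  with no insert show ?case by auto
qed

text \<open>Two such offsets would differ by a positive multiple of \<open>m\<close> that is smaller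
  than \<open>m\<close>.\<close>

lemma card_mod_shift_le_1:
  fixes m l :: nat
  shows "card ({..<m} \<inter> {s. (l + s) mod m = 0}) \<le> 1"
proof -
  have "\<not> s < s'" if "s' < m" "(l + s) mod m = 0" "(l + s') mod m = 0" for s s'
  proof
    assume "s < s'"
    have "m dvd (l + s') - (l + s)" using that by (intro dvd_diff_nat) auto
    then have "m dvd s' - s" by simp
    with \<open>s < s'\<close> \<open>s' < m\<close> show False by (auto dest: dvd_imp_le)
  qed
  then have "s = s'"
    if "s \<in> {..<m} \<inter> {s. (l + s) mod m = 0}" "s' \<in> {..<m} \<inter> {s. (l + s) mod m = 0}" for s s'
    using that by (metis (mono_tags, lifting) IntE lessThan_iff linorder_neqE_nat mem_Collect_eq)
  moreover have "finite ({..<m} \<inter> {s. (l + s) mod m = 0})" by blast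
  ultimately show ?thesis
    unfolding One_nat_def by (subst card_le_Suc0_iff_eq) (assumption, intro ballI)
qed

text \<open>Union bound: \<open>v\<close> is hit by the set drawn from \<open>p\<close> or by the
  uniform offset, of whose \<open>m\<close> values at most one is bad. Each contributes at most
  \<open>1 / m\<close>.\<close>

lemma prob_union_periodic_le:
  fixes p :: "'a set pmf" and lev :: "'a \<Rightarrow> nat"
  assumes "0 < m" and "measure_pmf.prob p {Y. v \<in> Y} \<le> 1 / real m"
  shows "measure_pmf.prob
      (map_pmf (\<lambda>(Y, s). Y \<union> {v \<in> V. (lev v + s) mod m = 0}) (pair_pmf p (pmf_of_set {..<m})))
      {Y. v \<in> Y} \<le> 2 / real m" (is "measure_pmf.prob (map_pmf ?f ?P) ?A \<le> _")
proof -
  let ?B = "{s. (lev v + s) mod m = 0}"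
  have ne: "{..<m} \<noteq> {}" "finite {..<m}" using \<open>0 < m\<close> by auto
  have "measure_pmf.prob (map_pmf ?f ?P) ?A = measure_pmf.prob ?P (?f -` ?A)"
    by (rule measure_map_pmf)
  also have "\<dots> \<le> measure_pmf.prob ?P (fst -` ?A \<union> snd -` ?B)"
    by (intro measure_pmf.finite_measure_mono) auto
  also have "\<dots> \<le> measure_pmf.prob ?P (fst -` ?A) + measure_pmf.prob ?P (snd -` ?B)"
    by (intro measure_subadditive) auto
  also have "measure_pmf.prob ?P (fst -` ?A) = measure_pmf.prob p ?A"
    using measure_map_pmf[of fst ?P ?A] by (simp only: map_fst_pair_pmf)
  also have "measure_pmf.prob ?P (snd -` ?B) = measure_pmf.prob (pmf_of_set {..<m}) ?B"
    using measure_map_pmf[of snd ?P ?B] by (simp only: map_snd_pair_pmf)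
  also have "\<dots> = card ({..<m} \<inter> ?B) / real m"
    using measure_pmf_of_set[OF ne, of ?B] by simp
  also have "\<dots> \<le> 1 / real m"
    using card_mod_shift_le_1[of m "lev v"] by (intro divide_right_mono) auto
  finally show ?thesis using assms(2) by simp
qed

text \<open>Stands in for a treedepth bound on what remains, so that the induction can run on
  relations such as \<open>same_level lev E\<close> without building graphs for them.\<close>

definition centered_deletion :: "'a rel \<Rightarrow> 'a set \<Rightarrow> nat \<Rightarrow> 'a set \<Rightarrow> bool" where
  "centered_deletion E V d Y \<longleftrightarrow>
     Y \<subseteq> V \<and> (\<exists>c. centered E (V - Y) c \<and> (\<forall>w\<in>V - Y. c w < d))"

text \<open>The bound solves the recursion \<open>r 0 a = 1\<close>,
  \<open>r (Suc t) a = 2 * a * r t (2 * a)\<close>. The induction hypothesis is applied once, to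
  \<open>same_level lev E\<close> on all of \<open>V\<close>, so one random set serves all levels.
  The budget \<open>1 / a\<close> is split evenly between this set and the deleted levels.\<close>

lemma eliminable_fragile:
  assumes "eliminable t E V" and "sym E" and "1 \<le> a"
  shows "\<exists>p. (\<forall>Y\<in>set_pmf p. centered_deletion E V (2 ^ (t * (t + 1) div 2) * a ^ t) Y) \<and>
     (\<forall>v\<in>V. measure_pmf.prob p {Y. v \<in> Y} \<le> 1 / real a)"
  using assms
proof (induction t arbitrary: E a)
  case 0
  have "x = y" if "(x, y) \<in> reach_in E V" for x y
    using that by induction (use eliminable_0_no_edge[OF 0(1,2)] in auto)
  \<comment> \<open>There are only loops, so one colour suffices and nothing is deleted.\<close>
  then have "centered E V (\<lambda>_. 0)" by (auto simp: centered_def)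
  then show ?case by (intro exI[of _ "return_pmf {}"]) (auto simp: centered_deletion_def)
next
  case (Suc t)
  obtain lev where el: "eliminable t (same_level lev E) V"
    and lay: "layering E V lev"
    using eliminable_levels[OF Suc.prems(1,2)] by blast
  define d where "d = 2 ^ (t * (t + 1) div 2) * (2 * a) ^ t"
  have sym': "sym (same_level lev E)" using Suc.prems(2) by (auto simp: sym_def)
  have "1 \<le> 2 * a" using Suc.prems(3) by simp
  from Suc.IH[OF el sym' this, folded d_def] obtain p
    where p: "\<And>Y. Y \<in> set_pmf p \<Longrightarrow> centered_deletion (same_level lev E) V d Y"
    and thin: "\<And>v. v \<in> V \<Longrightarrow> measure_pmf.prob p {Y. v \<in> Y} \<le> 1 / real (2 * a)"
    by blast
  let ?f = "\<lambda>(Y, s). Y \<union> {v \<in> V. (lev v + s) mod (2 * a) = 0}"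
  define p' where "p' = map_pmf ?f (pair_pmf p (pmf_of_set {..<2 * a}))"
  have "2 * a > 0" using Suc.prems(3) by simp
  have exponent: "Suc t * (Suc t + 1) div 2 = t * (t + 1) div 2 + t + 1"
  proof -
    have "Suc t * (Suc t + 1) = t * (t + 1) + (t + 1) * 2" by simp
    then show ?thesis by (simp only: div_mult_self1 div_mult_self3 div_mult_self2)
  qed
  have size: "2 ^ (Suc t * (Suc t + 1) div 2) * a ^ Suc t = 2 * a * d"
    unfolding exponent d_def by (simp add: power_add power_mult_distrib)
  have "centered_deletion E V (2 * a * d) Y"
    if Y': "Y \<in> set_pmf p'" for Y
  proof -
    from Y' obtain Y0 s where Y0: "Y0 \<in> set_pmf p"
      and Y: "Y = Y0 \<union> {v \<in> V. (lev v + s) mod (2 * a) = 0}"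
      unfolding p'_def by auto
    from p[OF Y0] obtain c where "Y0 \<subseteq> V" and c: "centered (same_level lev E) (V - Y0) c"
      and cd: "\<And>w. w \<in> V - Y0 \<Longrightarrow> c w < d" unfolding centered_deletion_def by blast
    let ?W = "V - Y" and ?c = "\<lambda>w. ((lev w + s) mod (2 * a)) * d + c w"
    have W: "?W \<subseteq> V - Y0" "?W \<subseteq> V" by (auto simp: Y)
    have "centered E ?W ?c"
    proof (rule centered_of_levels[OF Suc.prems(2)])
      show "centered (same_level lev E) ?W c" using c W(1) by (rule centered_subset)
    qed (use W layering_subset[OF lay W(2)] cd Y \<open>2 * a > 0\<close> in auto)
    moreover have "?c w < 2 * a * d" if "w \<in> ?W" for w
    proof -
      have "(lev w + s) mod (2 * a) < 2 * a" using \<open>2 * a > 0\<close> by (rule mod_less_divisor)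
      then have "Suc ((lev w + s) mod (2 * a)) * d \<le> 2 * a * d" by (intro mult_le_mono1) simp
      with cd[of w] that W(1) show ?thesis by auto
    qed
    ultimately show ?thesis using \<open>Y0 \<subseteq> V\<close>
      unfolding centered_deletion_def by (intro conjI exI[of _ ?c]) (auto simp: Y)
  qed
  moreover have "measure_pmf.prob p' {Y. v \<in> Y} \<le> 1 / real a" if "v \<in> V" for v
    using prob_union_periodic_le[OF \<open>2 * a > 0\<close> thin[OF that], of V lev] unfolding p'_def by simp
  ultimately show ?case unfolding size by blast
qed

section \<open>Treedepth from centered colourings\<close>

text \<open>The ancestors of \<open>v\<close> are the vertices \<open>u\<close> of smaller colour
  that reach \<open>v\<close> through colours at least \<open>c u\<close>; the parent is the
  ancestor of largest colour. Colours increase strictly along arcs, so \<open>v\<close> has depth at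
  most \<open>c v\<close>.\<close>

lemma treedepth_le_of_centered:
  assumes fin: "finite (verts G)"
    and adj: "\<And>u v. u \<rightarrow>\<^bsub>G\<^esub> v \<Longrightarrow> u \<in> verts G \<and> v \<in> verts G \<and> (u, v) \<in> E"
    and "sym E" and c: "centered E (verts G) c" and d: "\<And>v. v \<in> verts G \<Longrightarrow> c v < d"
  shows "treedepth G \<le> d"
proof -
  define W where "W = verts G"
  define anc where "anc u v \<longleftrightarrow> u \<in> W \<and> v \<in> W \<and> c u < c v \<and> (u, v) \<in> reach_in E {w \<in> W. c u \<le> c w}"
    for u v
  define A where "A = {(p, v). anc p v \<and> (\<forall>u. anc u v \<longrightarrow> c u \<le> c p)}"
  let ?F = "\<lparr>pverts = verts G, parcs = A\<rparr>"
  have A_sub: "A \<subseteq> verts G \<times> verts G" by (auto simp: A_def anc_def W_def)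
  then have fin_F: "pair_fin_digraph ?F"
    using finite_subset[OF A_sub] fin by unfold_locales auto
  have "A \<subseteq> inv_image less_than c" by (auto simp: A_def anc_def)
  then have acyc: "acyclic A" by (rule acyclic_subset[OF wf_acyclic[OF wf_inv_image[OF wf_less_than]]])
  \<comment> \<open>Joining the two walks at \<open>v\<close> connects \<open>u\<close> to
    \<open>u'\<close> through colours at least \<open>c u\<close>. If the colours agree,
    centeredness forces \<open>u = u'\<close>.\<close>
  have chain: "u = u' \<or> anc u u'" if "anc u v" "anc u' v" "c u \<le> c u'" for u u' v
  proof -
    have "(u', v) \<in> reach_in E {w \<in> W. c u \<le> c w}"
      by (rule reach_in_mono[of "{w \<in> W. c u' \<le> c w}"]) (use that in \<open>auto simp: anc_def\<close>)
    then have "(v, u') \<in> reach_in E {w \<in> W. c u \<le> c w}"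
      using sym_reach_in[OF \<open>sym E\<close>] by (auto dest: symD)
    with that(1) have uu': "(u, u') \<in> reach_in E {w \<in> W. c u \<le> c w}"
      unfolding anc_def by (meson rtrancl_trans)
    show ?thesis
    proof (cases "c u = c u'")
      case True
      moreover have "u \<in> verts G" "u' \<in> verts G" using that by (simp_all add: anc_def W_def)
      ultimately show ?thesis
        using uu' c[unfolded centered_def, rule_format, of u u'] by (simp add: W_def)
    next
      case False
      with uu' that show ?thesis by (simp add: anc_def)
    qed
  qed
  \<comment> \<open>Colours of ancestors are bounded by \<open>c v\<close>, so a greatest one
    exists.\<close>
  have parent: "\<exists>p. (p, v) \<in> A" if "anc u v" for u v
    using ex_has_greatest_nat[of "\<lambda>u. anc u v" u c "c v"] that
    unfolding A_def by (auto simp: anc_def)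
  have unique: "p = p'" if "(p, v) \<in> A" "(p', v) \<in> A" for p p' v
  proof -
    have "anc p v" "anc p' v" "c p = c p'" using that by (auto simp: A_def intro: antisym)
    with chain[of p v p'] show ?thesis by (auto simp: anc_def)
  qed
  have indeg: "in_degree (with_proj ?F) v \<le> 1" for v
  proof -
    have "e = e'" if "e \<in> in_arcs (with_proj ?F) v" "e' \<in> in_arcs (with_proj ?F) v" for e e'
      using that unique by (cases e; cases e') auto
    then show ?thesis unfolding in_degree_def One_nat_def
      by (metis card.infinite card_le_Suc0_iff_eq le0)
  qed
  have root: "\<exists>r\<in>forest_roots ?F. \<exists>n\<le>c v. (r, v) \<in> A ^^ n" if "v \<in> W" for v
    using that
  proof (induction "c v" arbitrary: v rule: less_induct)
    case less
    show ?case
    proof (cases "\<exists>p. (p, v) \<in> A")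
      case True
      then obtain p where p: "(p, v) \<in> A" by blast
      then have "c p < c v" "p \<in> W" by (auto simp: A_def anc_def)
      from less.hyps[OF this] obtain r n where "r \<in> forest_roots ?F" "n \<le> c p" "(r, p) \<in> A ^^ n"
        by blast
      with p \<open>c p < c v\<close> show ?thesis by (intro bexI[of _ r] exI[of _ "Suc n"]) auto
    next
      case False
      then have "in_arcs (with_proj ?F) v = {}" by auto
      then have "v \<in> forest_roots ?F"
        using less.prems by (simp add: forest_roots_def in_degree_def W_def)
      then show ?thesis by (intro bexI[of _ v] exI[of _ 0]) auto
    qed
  qed
  have depth: "depth_less ?F d"
    unfolding depth_less_def
  proof
    fix v assume "v \<in> pverts ?F"
    then show "\<exists>r\<in>forest_roots ?F. \<exists>n<d. (r, v) \<in> parcs ?F ^^ n"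
      using root[of v] d[of v] by (auto simp: W_def intro: le_less_trans)
  qed
  have anc_reach: "(u, v) \<in> A\<^sup>*" if "anc u v" for u v
    using that
  proof (induction "c v" arbitrary: v rule: less_induct)
    case less
    obtain p where p: "(p, v) \<in> A" using parent[OF less.prems] by blast
    then have "anc p v" "c u \<le> c p" using less.prems by (auto simp: A_def)
    with chain[OF less.prems] have "u = p \<or> anc u p" by blast
    moreover have "c p < c v" using \<open>anc p v\<close> by (simp add: anc_def)
    ultimately have "(u, p) \<in> A\<^sup>*" using less.hyps by blast
    with p show ?case by (rule rtrancl_into_rtrancl[rotated])
  qed
  have edge: "(u, v) \<in> A\<^sup>*" if "u \<in> W" "v \<in> W" "(u, v) \<in> E" "c u \<le> c v" for u v
  proof -
    have "(u, v) \<in> reach_in E {w \<in> W. c u \<le> c w}" using that by blast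
    with that c[unfolded centered_def, rule_format, of u v] have "u = v \<or> anc u v"
      by (cases "c u = c v") (simp_all add: anc_def W_def)
    then show ?thesis using anc_reach by blast
  qed
  interpret F: pair_fin_digraph ?F by (fact fin_F)
  have "u \<rightarrow>\<^sup>*\<^bsub>with_proj ?F\<^esub> v \<or> v \<rightarrow>\<^sup>*\<^bsub>with_proj ?F\<^esub> u" if uv: "u \<rightarrow>\<^bsub>G\<^esub> v" for u v
  proof -
    have "(v, u) \<in> E" using adj[OF uv] \<open>sym E\<close> by (auto dest: symD)
    then have "(u, v) \<in> A\<^sup>* \<or> (v, u) \<in> A\<^sup>*"
      using edge[of u v] edge[of v u] adj[OF uv] by (cases "c u \<le> c v") (auto simp: W_def)
    moreover have "u \<in> verts G" "v \<in> verts G" using adj[OF uv] by auto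
    ultimately show ?thesis by (auto simp: F.reachable_conv)
  qed
  then have "\<exists>F. treedepth_forest G F \<and> depth_less F d"
    using fin_F acyc indeg depth
    by (intro exI[of _ ?F]) (auto simp: treedepth_forest_def rooted_forest_def)
  then show ?thesis unfolding treedepth_def by (rule Least_le)
qed

section \<open>From tree decompositions to elimination orderings\<close>

lemma graph_sym_parcs:
  assumes "graph (with_proj T)"
  shows "sym (parcs T)"
proof -
  interpret graph "with_proj T" by fact
  show ?thesis using sym_arcs by (simp add: symmetric_def)
qed

lemma arcs_ends_induce_with_proj: "arcs_ends (with_proj T \<restriction> S) = parcs T \<inter> S \<times> S"
  by (auto simp: arcs_ends_def arc_to_ends_def image_iff)

text \<open>The induced subgraph is symmetric, so it is strongly connected and has directed walks
  inside \<open>S\<close>.\<close>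

lemma connected_induce_reach_in:
  assumes "graph (with_proj T)" and "Digraph_Component.connected (with_proj T \<restriction> S)"
    and "x \<in> S" and "y \<in> S"
  shows "(x, y) \<in> reach_in (parcs T) S"
proof -
  interpret T: graph "with_proj T" by fact
  let ?H = "with_proj T \<restriction> S"
  have "wf_digraph ?H" by (rule T.wellformed_induce_subgraph)
  then interpret H: wf_digraph ?H .
  have "symmetric ?H"
    unfolding symmetric_def arcs_ends_induce_with_proj
    using graph_sym_parcs[OF assms(1)] by (auto simp: sym_def)
  with assms(2) have "strongly_connected ?H"
    using H.symmetric_connected_imp_strongly_connected by blast
  then have "x \<rightarrow>\<^sup>*\<^bsub>?H\<^esub> y" using assms(3,4) by (auto simp: strongly_connected_def)
  then show ?thesis by (simp add: H.reachable_conv arcs_ends_induce_with_proj)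
qed

text \<open>A path from \<open>u\<close> to \<open>w\<close> inside \<open>S\<close> is closed up
  through \<open>y\<close>. It has an arc because \<open>u\<close> and \<open>w\<close> differ, and
  it avoids \<open>y\<close> because \<open>y\<close> is outside \<open>S\<close>.\<close>

lemma cycle_through_new_vertex:
  assumes T: "graph (with_proj T)" and S: "S \<subseteq> pverts T" "y \<notin> S"
    and uw: "u \<in> S" "w \<in> S" "u \<noteq> w" "(u, y) \<in> parcs T" "(w, y) \<in> parcs T"
    and reach: "(u, w) \<in> reach_in (parcs T) S"
  shows "\<exists>p. pre_digraph.cycle (with_proj T) p \<and> 3 \<le> length p"
proof -
  interpret T: graph "with_proj T" by fact
  let ?H = "with_proj T \<restriction> S"
  have "wf_digraph ?H" by (rule T.wellformed_induce_subgraph)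
  then interpret H: wf_digraph ?H .
  have "u \<rightarrow>\<^sup>*\<^bsub>?H\<^esub> w" using reach uw by (simp add: H.reachable_conv arcs_ends_induce_with_proj)
  then obtain p where p: "H.apath u p w" by (auto simp: H.reachable_apath)
  have "subgraph ?H (with_proj T)"
    using S(1) T.induced_induce by (intro induced_imp_subgraph) simp
  then have pT: "T.apath u p w" using p by (rule T.subgraph_apath_imp_apath[rotated])
  have "set (H.awalk_verts u p) \<subseteq> S" using p H.awalk_conv[of u p w] by (simp add: H.apath_def)
  then have in_S: "set (T.awalk_verts u p) \<subseteq> S"
    by (simp add: compatible_awalk_verts[OF compatible_induce_subgraph])
  have "p \<noteq> []" using pT uw(3) by (auto simp: T.apath_def T.awalk_Nil_iff)
  have walk: "T.awalk u p w" and last: "T.awlast u p = w" using pT by (auto simp: T.apath_def)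
  have "(y, u) \<in> parcs T" using uw(4) graph_sym_parcs[OF T] by (auto dest: symD)
  have ww: "T.awalk w [(w, y)] y"
    using uw(5) T.head_in_verts[of "(w, y)"] by (auto simp: T.awalk_simps)
  have uy: "T.awalk u (p @ [(w, y)]) y" using walk ww last by simp
  have "T.awalk y ((y, u) # p @ [(w, y)]) y"
    using uy \<open>(y, u) \<in> parcs T\<close> by (simp add: T.awalk_Cons_iff del: T.awalk_append_iff)
  moreover have "T.awalk_verts u (p @ [(w, y)]) = T.awalk_verts u p @ [y]"
    using T.awalk_verts_append[OF uy] last by simp
  then have "distinct (tl (T.awalk_verts y ((y, u) # p @ [(w, y)])))"
    using pT in_S S(2) by (auto simp: T.apath_def)
  ultimately have "T.cycle ((y, u) # p @ [(w, y)])" by (auto simp: T.cycle_def)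
  moreover have "3 \<le> length ((y, u) # p @ [(w, y)])" using \<open>p \<noteq> []\<close> by (cases p) auto
  ultimately show ?thesis by blast
qed

lemma rtrancl_exits:
  assumes "(x, z) \<in> R\<^sup>*" and "x \<in> S" and "z \<notin> S"
  shows "\<exists>s\<in>S. \<exists>y. y \<notin> S \<and> (s, y) \<in> R"
  using assms by (induction rule: rtrancl_induct) auto

text \<open>Take a largest connected part \<open>S\<close> that is already eliminable. If it is not
  the whole tree, some \<open>y\<close> outside is adjacent to it, and a second neighbour of
  \<open>y\<close> in \<open>S\<close> would create a cycle; so \<open>y\<close> can be
  added.\<close>

lemma undirected_tree_eliminable:
  assumes "undirected_tree (with_proj T)"
  shows "eliminable 1 (parcs T) (pverts T)"
proof -
  have T: "graph (with_proj T)" and conn: "Digraph_Component.connected (with_proj T)"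
    and acyc: "\<not> (\<exists>p. pre_digraph.cycle (with_proj T) p \<and> 3 \<le> length p)"
    using assms by (simp_all add: undirected_tree_def)
  interpret T: graph "with_proj T" by (fact T)
  have fin: "finite (pverts T)" using T.finite_verts by simp
  have sym: "sym (parcs T)" using T by (rule graph_sym_parcs)
  have "with_proj T \<restriction> pverts T = with_proj T"
    using T.wellformed by (auto simp: induce_subgraph_def with_proj_def)
  then have reach: "(x, y) \<in> reach_in (parcs T) (pverts T)" if "x \<in> pverts T" "y \<in> pverts T" for x y
    using connected_induce_reach_in[OF T _ that] conn by simp
  \<comment> \<open>Connectedness within \<open>S\<close> belongs to the invariant, as it supplies
    the walk that a second neighbour of the new vertex would close to a cycle.\<close>
  define P where "P S \<longleftrightarrow> S \<subseteq> pverts T \<and> S \<noteq> {} \<and> eliminable 1 (parcs T) S \<and>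
    (\<forall>x\<in>S. \<forall>y\<in>S. (x, y) \<in> reach_in (parcs T) S)" for S
  obtain r where "r \<in> pverts T"
    using conn by (auto simp: connected_def strongly_connected_def mk_symmetric_def)
  have "eliminable 1 (parcs T) (insert r {})"
    by (intro eliminable.insert eliminable.empty) auto
  with \<open>r \<in> pverts T\<close> have "P {r}" by (auto simp: P_def)
  have bound: "\<forall>S. P S \<longrightarrow> card S < Suc (card (pverts T))"
    using fin by (auto simp: P_def less_Suc_eq_le intro: card_mono)
  obtain S where S: "P S" and max: "\<forall>S'. P S' \<longrightarrow> card S' \<le> card S"
    using ex_has_greatest_nat[OF \<open>P {r}\<close> bound] by metis
  have S': "S \<subseteq> pverts T" "S \<noteq> {}" "eliminable 1 (parcs T) S"
    and S_reach: "\<And>x y. x \<in> S \<Longrightarrow> y \<in> S \<Longrightarrow> (x, y) \<in> reach_in (parcs T) S"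
    using S unfolding P_def by blast+
  have "finite S" using S'(1) fin by (rule finite_subset)
  have "S = pverts T"
  proof (rule ccontr)
    assume "S \<noteq> pverts T"
    then obtain x z where "x \<in> S" "z \<in> pverts T" "z \<notin> S" using S' by blast
    then obtain s y where s: "s \<in> S" "y \<notin> S" "(s, y) \<in> parcs T" "y \<in> pverts T"
      using rtrancl_exits[OF reach[of x z]] S'(1) by blast
    have one: "u = w" if "u \<in> S" "w \<in> S" "(u, y) \<in> parcs T" "(w, y) \<in> parcs T" for u w
      using cycle_through_new_vertex[OF T S'(1) s(2) that(1,2) _ that(3,4) S_reach[OF that(1,2)]] acyc
      by blast
    then have "card {u \<in> S. (u, y) \<in> parcs T} \<le> 1"
      unfolding One_nat_def using \<open>finite S\<close> by (subst card_le_Suc0_iff_eq) auto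
    then have "eliminable 1 (parcs T) (insert y S)"
      using S'(3) s(2) one by (intro eliminable.insert) auto
    moreover have "(u, w) \<in> reach_in (parcs T) (insert y S)" if "u \<in> insert y S" "w \<in> insert y S" for u w
    proof -
      have old: "(u, w) \<in> reach_in (parcs T) (insert y S)" if "u \<in> S" "w \<in> S" for u w
        by (rule reach_in_mono[OF _ S_reach[OF that]]) auto
      have "(s, y) \<in> reach_in (parcs T) (insert y S)" using s by blast
      then have to_y: "(u, y) \<in> reach_in (parcs T) (insert y S)" if "u \<in> insert y S" for u
        using old[of u s] s(1) that by (auto intro: rtrancl_trans)
      have "(y, w) \<in> reach_in (parcs T) (insert y S)"
        by (rule symD[OF sym_reach_in[OF sym] to_y[OF that(2)]])
      with to_y[OF that(1)] show ?thesis by (rule rtrancl_trans)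
    qed
    ultimately have "P (insert y S)" using S'(1) s(4) by (auto simp: P_def)
    then show False using max[rule_format, of "insert y S"] s(2) \<open>finite S\<close> by simp
  qed
  then show ?thesis using S'(3) by simp
qed

text \<open>With all nodes of a tree decomposition as \<open>N\<close>, this is the supergraph in
  which the bags are cliques. The node set is a parameter so that nodes can be added one by
  one.\<close>

definition cobag :: "('n \<Rightarrow> 'a set) \<Rightarrow> 'n set \<Rightarrow> 'a rel" where
  "cobag B N = {(u, v). u \<noteq> v \<and> (\<exists>x\<in>N. u \<in> B x \<and> v \<in> B x)}"

text \<open>Each node \<open>y\<close> is added as a leaf or as the first node. A vertex of
  \<open>B y\<close> that is in no earlier bag has all its neighbours in \<open>B y\<close>, which
  is a clique with at most \<open>k\<close> other vertices.\<close>

lemma eliminable_cobag: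
  assumes "eliminable 1 A N" and "sym A"
    and "\<And>v x z. x \<in> N \<Longrightarrow> z \<in> N \<Longrightarrow> v \<in> B x \<Longrightarrow> v \<in> B z \<Longrightarrow> (x, z) \<in> reach_in A {n \<in> N. v \<in> B n}"
    and "\<And>x. x \<in> N \<Longrightarrow> finite (B x) \<and> card (B x) \<le> Suc k"
  shows "eliminable k (cobag B N) (\<Union>x\<in>N. B x)"
  using assms(1,3,4)
proof (induction rule: eliminable.induct)
  case empty
  then show ?case by (simp add: eliminable.empty)
next
  case (insert N y)
  note conn = insert.prems(1)
  have clique: "pairwise (\<lambda>u w. (u, w) \<in> A) {u \<in> {n \<in> insert y N. v \<in> B n} - {y}. (u, y) \<in> A}" for v
    using insert.hyps(3) by (auto simp: pairwise_def)
  have remove_y: "{n \<in> insert y N. v \<in> B n} - {y} = {n \<in> N. v \<in> B n}" for v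
    using insert.hyps(2) by auto
  have conn_N: "(x, z) \<in> reach_in A {n \<in> N. v \<in> B n}"
    if "x \<in> N" "z \<in> N" "v \<in> B x" "v \<in> B z" for v x z
  proof -
    have "x \<noteq> y" "z \<noteq> y" using that insert.hyps(2) by auto
    have "(x, z) \<in> reach_in A {n \<in> insert y N. v \<in> B n}" by (rule conn) (use that in auto)
    from reach_in_remove_simplicial[OF \<open>sym A\<close> clique this \<open>x \<noteq> y\<close>] \<open>z \<noteq> y\<close>
    show ?thesis unfolding remove_y by simp
  qed
  define U where "U = (\<Union>x\<in>N. B x)"
  have IH: "eliminable k (cobag B N) U"
    unfolding U_def using conn_N insert.prems(2) by (intro insert.IH) auto
  \<comment> \<open>A walk from an older node containing \<open>v\<close> to \<open>y\<close>,
    through nodes containing \<open>v\<close>, reaches \<open>y\<close> from a neighbour whose bag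
    contains \<open>v\<close>.\<close>
  have nbr: "\<exists>p\<in>N. (p, y) \<in> A \<and> v \<in> B p" if v: "v \<in> U" "v \<in> B y" for v
  proof -
    from v obtain x where x: "x \<in> N" "v \<in> B x" by (auto simp: U_def)
    have "x \<noteq> y" using x insert.hyps(2) by auto
    have "(x, y) \<in> reach_in A {n \<in> insert y N. v \<in> B n}" by (rule conn) (use x v in auto)
    from reach_in_remove_simplicial[OF \<open>sym A\<close> clique this \<open>x \<noteq> y\<close>]
    show ?thesis unfolding remove_y by auto
  qed
  have "finite N" using insert.hyps(1) by (rule eliminable_finite)
  then have unique: "p = p'" if "p \<in> N" "p' \<in> N" "(p, y) \<in> A" "(p', y) \<in> A" for p p'
    using insert.hyps(4) that unfolding One_nat_def by (subst (asm) card_le_Suc0_iff_eq) auto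
  \<comment> \<open>Two older vertices that meet in \<open>B y\<close> both lie in the bag of the
    unique neighbour of \<open>y\<close>, so the new bag adds no edge between them.\<close>
  have old: "(u, v) \<in> cobag B N \<longleftrightarrow> (u, v) \<in> cobag B (insert y N)" if "u \<in> U" "v \<in> U" for u v
    using nbr[of u] nbr[of v] unique that by (fastforce simp: cobag_def)
  have By: "finite (B y)" "card (B y) \<le> Suc k" using insert.prems(2) by auto
  \<comment> \<open>The new vertices of \<open>B y\<close> are appended one at a time;
    \<open>D\<close> collects those already added.\<close>
  have "eliminable k (cobag B (insert y N)) (U \<union> D)" if "finite D" "D \<subseteq> B y - U" for D
    using that
  proof (induction rule: finite_induct)
    case empty
    show ?case using eliminable_cong[OF IH old] by simp
  next
    case (insert v D)
    have nb: "u \<in> B y - {v}" if "(u, v) \<in> cobag B (insert y N)" for u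
      using that insert.prems by (auto simp: cobag_def U_def)
    have "card {u \<in> U \<union> D. (u, v) \<in> cobag B (insert y N)} \<le> card (B y - {v})"
      using nb By(1) by (intro card_mono) auto
    also have "\<dots> \<le> k" using By insert.prems by simp
    finally have "eliminable k (cobag B (insert y N)) (insert v (U \<union> D))"
      using insert nb by (intro eliminable.insert) (auto simp: cobag_def[of B "insert y N"])
    then show ?case by simp
  qed
  from this[of "B y - U"] By(1) have "eliminable k (cobag B (insert y N)) (U \<union> B y)" by simp
  then show ?case by (simp add: U_def Un_commute)
qed

text \<open>The relation is \<open>cobag\<close> of an optimal decomposition. Width at most
  \<open>t\<close> means bags of at most \<open>Suc t\<close> vertices, which leaves at most
  \<open>t\<close> earlier neighbours.\<close>

lemma treewidth_le_eliminable:
  assumes "graph G" and "treewidth G \<le> int t"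
  shows "\<exists>E. sym E \<and> eliminable t E (verts G) \<and> arcs_ends G \<subseteq> E"
proof -
  interpret G: graph G by fact
  obtain T B where TB: "tree_decomposition G T B" "decomposition_width T B \<le> int t"
    using treewidth_attained(1)[OF assms(1)] assms(2) by metis
  have tree: "undirected_tree (with_proj T)" and cover: "(\<Union>x\<in>pverts T. B x) = verts G"
    and edges: "\<And>u v. u \<rightarrow>\<^bsub>G\<^esub> v \<Longrightarrow> \<exists>x\<in>pverts T. u \<in> B x \<and> v \<in> B x"
    and conn: "\<And>v. v \<in> verts G \<Longrightarrow>
      Digraph_Component.connected (with_proj T \<restriction> {x \<in> pverts T. v \<in> B x})"
    using TB(1) by (auto simp: tree_decomposition_def)
  have T: "graph (with_proj T)" using tree by (simp add: undirected_tree_def)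
  then interpret T: graph "with_proj T" .
  have fin: "finite (pverts T)" using T.finite_verts by simp
  have bag: "finite (B x) \<and> card (B x) \<le> Suc t" if x: "x \<in> pverts T" for x
  proof
    show "finite (B x)" using cover x G.finite_verts by (auto intro: finite_subset)
    have "int (card (B x)) \<le> Max ((\<lambda>x. int (card (B x))) ` pverts T)"
      using fin x by (intro Max_ge) auto
    then show "card (B x) \<le> Suc t" using TB(2) by (simp add: decomposition_width_def)
  qed
  have "eliminable t (cobag B (pverts T)) (\<Union>x\<in>pverts T. B x)"
  proof (rule eliminable_cobag[OF undirected_tree_eliminable[OF tree] graph_sym_parcs[OF T] _ bag])
    fix v x z assume *: "x \<in> pverts T" "z \<in> pverts T" "v \<in> B x" "v \<in> B z"
    then have "v \<in> verts G" using cover by blast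
    from conn[OF this] show "(x, z) \<in> reach_in (parcs T) {n \<in> pverts T. v \<in> B n}"
      by (rule connected_induce_reach_in[OF T]) (use * in auto)
  qed
  moreover have "sym (cobag B (pverts T))" by (auto simp: sym_def cobag_def)
  moreover have "arcs_ends G \<subseteq> cobag B (pverts T)"
    using edges G.adj_not_same by (fastforce simp: cobag_def)
  ultimately show ?thesis unfolding cover by blast
qed

section \<open>Fractional fragility of graphs of bounded treewidth\<close>

text \<open>A colouring that is centered for the supergraph \<open>E\<close> also bounds the
  treedepth of the subgraph, because \<open>treedepth_le_of_centered\<close> only asks that the arcs
  lie in \<open>E\<close>.\<close>

lemma treedepth_delete_verts_le:
  assumes "graph G" and "sym E" and "arcs_ends G \<subseteq> E" and "centered_deletion E (verts G) d Y"
  shows "treedepth (delete_verts G Y) \<le> d"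
proof -
  interpret G: graph G by fact
  obtain c where c: "centered E (verts G - Y) c" "\<And>w. w \<in> verts G - Y \<Longrightarrow> c w < d"
    using assms(4) unfolding centered_deletion_def by blast
  have "u \<in> verts G - Y \<and> v \<in> verts G - Y \<and> (u, v) \<in> E" if "u \<rightarrow>\<^bsub>delete_verts G Y\<^esub> v" for u v
    using that assms(3) by (auto simp: delete_verts_def arcs_ends_def arc_to_ends_def)
  then show ?thesis
    using c G.finite_verts by (intro treedepth_le_of_centered[OF _ _ assms(2)]) (auto simp: delete_verts_def)
qed

theorem theorem28:
  fixes t :: nat
  shows "fractionally_fragile_class (\<lambda>G. real (treedepth G))
           (\<lambda>a. 2 ^ (t * (t + 1) div 2 + 1) * real a ^ t)
           {G :: ('a,'b) pre_digraph. graph G \<and> treewidth G \<le> int t}"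
  unfolding fractionally_fragile_class_def fractionally_fragile_def
proof (intro ballI conjI allI impI)
  show "rate_function (\<lambda>a. 2 ^ (t * (t + 1) div 2 + 1) * real a ^ t)"
    unfolding rate_function_def mono_def by (auto intro: mult_left_mono power_mono)
next
  fix G :: "('a,'b) pre_digraph" and a :: nat
  assume "G \<in> {G. graph G \<and> treewidth G \<le> int t}" and "1 \<le> a"
  then have "graph G" "treewidth G \<le> int t" by auto
  then obtain E where E: "sym E" "eliminable t E (verts G)" "arcs_ends G \<subseteq> E"
    using treewidth_le_eliminable by blast
  let ?d = "2 ^ (t * (t + 1) div 2) * a ^ t"
  obtain p where p: "\<And>Y. Y \<in> set_pmf p \<Longrightarrow> centered_deletion E (verts G) ?d Y"
    and thin: "\<And>v. v \<in> verts G \<Longrightarrow> measure_pmf.prob p {Y. v \<in> Y} \<le> 1 / real a"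
    using eliminable_fragile[OF E(2,1) \<open>1 \<le> a\<close>] by blast
  have "Y \<subseteq> verts G \<and> real (treedepth (delete_verts G Y)) \<le> 2 ^ (t * (t + 1) div 2 + 1) * real a ^ t"
    if "Y \<in> set_pmf p" for Y
  proof
    show "Y \<subseteq> verts G" using p[OF that] by (simp add: centered_deletion_def)
    have "treedepth (delete_verts G Y) \<le> ?d"
      using treedepth_delete_verts_le[OF \<open>graph G\<close> E(1,3) p[OF that]] .
    then have "real (treedepth (delete_verts G Y)) \<le> real ?d" by (rule of_nat_mono)
    \<comment> \<open>The bound \<open>?d\<close> is half of the claimed rate.\<close>
    also have "\<dots> \<le> 2 ^ (t * (t + 1) div 2 + 1) * real a ^ t" by simp
    finally show "real (treedepth (delete_verts G Y)) \<le> 2 ^ (t * (t + 1) div 2 + 1) * real a ^ t" .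
  qed
  then show "\<exists>p. set_pmf p \<subseteq> {Y. Y \<subseteq> verts G \<and> real (treedepth (delete_verts G Y))
        \<le> 2 ^ (t * (t + 1) div 2 + 1) * real a ^ t} \<and> thin G (1 / real a) p"
    using thin unfolding thin_def by blast
qed

end
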